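(* Let $(X,T,A)$ be a soft $T_{0U}$ topological space. Then $(X,T,A)$ is a soft $T_{(0,2)}$ space if and only if for each $x,y\in X$ with $x\not\approx y$, there are soft open sets $(G,A)$ and $(H,A)$ such that $x\in(G,A)$, $y\in(H,A)$ and $(G,A)\sqcap(H,A)=0_A$.
   Context: A soft set over a set $X$ with parameter set $A$ is a pair $(F,A)$ with $F:A\to\mathcal P(X)$; $SS(X)_A$ is the set of all of them. $0_A$ and $1_A$ denote the soft sets with constant value $\emptyset$, respectively $X$. Soft union, soft intersection $\sqcap$, complement $(F,A)^c$ and inclusion $\sqsubseteq$ are defined parameterwise. For $x\in X$, $x\in(F,A)$ means $x\in F(a)$ for all $a\in A$. A soft topology on $X$ is a family $T\subseteq SS(X)_A$ containing $0_A,1_A$ and closed under binary soft intersections and arbitrary soft unions; members of $T$ are soft open. A soft neighbourhood of $x$ is a soft set $(F,A)$ such that $x\in(G,A)\sqsubseteq(F,A)$ for some $(G,A)\in T$; $\mathcal U_x$ is the collection of these. Write $x\approx y$ if $x\in(G,A)$ for each $(G,A)\in\mathcal U_y$ and $y\in(F,A)$ for each $(F,A)\in\mathcal U_x$. The space is soft $T_{0U}$ if whenever $x\approx y$, for every $a\in A$ and $(F,A)\in T$: $x\in F(a)$ if and only if $y\in F(a)$. Soft $T_0$ reflection: $X_0$ is the set of equivalence classes of $\approx$ on $X$, $r_X:X\to X_0$ the canonical surjection, and $T_0$ is the soft topology on $X_0$ consisting of those $(F,A)\in SS(X_0)_A$ for which the soft set $a\mapsto r_X^{-1}(F(a))$ belongs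 to $T$; $(X_0,T_0,A)$ is the soft $T_0$ reflection of $(X,T,A)$. A soft topological space is soft $T_2$ if for all distinct points $x,y$ there are soft open sets $(F,A),(G,A)$ with $x\in(F,A)$, $y\in(G,A)$ and $(F,A)\sqcap(G,A)=0_A$. $(X,T,A)$ is soft $T_{(0,2)}$ if $(X_0,T_0,A)$ is soft $T_2$. *)

theory Defs
  imports Main "HOL-Library.FuncSet"
begin

text \<open>
  Carriers are sets rather than whole types, since the reflection lives on a set of equivalence
  classes.  A soft set \<open>(F,A)\<close> is an extensional function on \<open>A\<close>, so that equality of soft
  sets is equality of functions.
\<close>

definition soft_sets :: "'a set \<Rightarrow> 'p set \<Rightarrow> ('p \<Rightarrow> 'a set) set" where
  "soft_sets X A = A \<rightarrow>\<^sub>E Pow X"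

definition soft_null :: "'p set \<Rightarrow> 'p \<Rightarrow> 'a set" where
  "soft_null A = (\<lambda>a\<in>A. {})"

definition soft_whole :: "'a set \<Rightarrow> 'p set \<Rightarrow> 'p \<Rightarrow> 'a set" where
  "soft_whole X A = (\<lambda>a\<in>A. X)"

definition soft_inter :: "'p set \<Rightarrow> ('p \<Rightarrow> 'a set) \<Rightarrow> ('p \<Rightarrow> 'a set) \<Rightarrow> 'p \<Rightarrow> 'a set" where
  "soft_inter A F G = (\<lambda>a\<in>A. F a \<inter> G a)"

definition soft_Union :: "'p set \<Rightarrow> ('p \<Rightarrow> 'a set) set \<Rightarrow> 'p \<Rightarrow> 'a set" where
  "soft_Union A S = (\<lambda>a\<in>A. \<Union>F\<in>S. F a)"

definition soft_le :: "'p set \<Rightarrow> ('p \<Rightarrow> 'a set) \<Rightarrow> ('p \<Rightarrow> 'a set) \<Rightarrow> bool" where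
  "soft_le A F G \<longleftrightarrow> (\<forall>a\<in>A. F a \<subseteq> G a)"

definition soft_mem :: "'p set \<Rightarrow> 'a \<Rightarrow> ('p \<Rightarrow> 'a set) \<Rightarrow> bool" where
  "soft_mem A x F \<longleftrightarrow> (\<forall>a\<in>A. x \<in> F a)"

definition soft_topology :: "'a set \<Rightarrow> 'p set \<Rightarrow> ('p \<Rightarrow> 'a set) set \<Rightarrow> bool" where
  "soft_topology X A T \<longleftrightarrow>
     T \<subseteq> soft_sets X A \<and> soft_null A \<in> T \<and> soft_whole X A \<in> T \<and>
     (\<forall>F\<in>T. \<forall>G\<in>T. soft_inter A F G \<in> T) \<and>
     (\<forall>S. S \<subseteq> T \<longrightarrow> soft_Union A S \<in> T)"

definition soft_nbhds :: "'a set \<Rightarrow> 'p set \<Rightarrow> ('p \<Rightarrow> 'a set) set \<Rightarrow> 'a \<Rightarrow> ('p \<Rightarrow> 'a set) set" where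
  "soft_nbhds X A T x = {F \<in> soft_sets X A. \<exists>G\<in>T. soft_mem A x G \<and> soft_le A G F}"

definition soft_equiv :: "'a set \<Rightarrow> 'p set \<Rightarrow> ('p \<Rightarrow> 'a set) set \<Rightarrow> 'a \<Rightarrow> 'a \<Rightarrow> bool" where
  "soft_equiv X A T x y \<longleftrightarrow>
     (\<forall>G\<in>soft_nbhds X A T y. soft_mem A x G) \<and> (\<forall>F\<in>soft_nbhds X A T x. soft_mem A y F)"

definition soft_T0U :: "'a set \<Rightarrow> 'p set \<Rightarrow> ('p \<Rightarrow> 'a set) set \<Rightarrow> bool" where
  "soft_T0U X A T \<longleftrightarrow>
     (\<forall>x\<in>X. \<forall>y\<in>X. soft_equiv X A T x y \<longrightarrow> (\<forall>a\<in>A. \<forall>F\<in>T. x \<in> F a \<longleftrightarrow> y \<in> F a))"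

definition soft_equiv_rel :: "'a set \<Rightarrow> 'p set \<Rightarrow> ('p \<Rightarrow> 'a set) set \<Rightarrow> ('a \<times> 'a) set" where
  "soft_equiv_rel X A T = {(x, y). x \<in> X \<and> y \<in> X \<and> soft_equiv X A T x y}"

definition T0_points :: "'a set \<Rightarrow> 'p set \<Rightarrow> ('p \<Rightarrow> 'a set) set \<Rightarrow> 'a set set" where
  "T0_points X A T = X // soft_equiv_rel X A T"

definition T0_proj :: "'a set \<Rightarrow> 'p set \<Rightarrow> ('p \<Rightarrow> 'a set) set \<Rightarrow> 'a \<Rightarrow> 'a set" where
  "T0_proj X A T x = soft_equiv_rel X A T `` {x}"

definition T0_topology :: "'a set \<Rightarrow> 'p set \<Rightarrow> ('p \<Rightarrow> 'a set) set \<Rightarrow> ('p \<Rightarrow> 'a set set) set" where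
  "T0_topology X A T =
     {F \<in> soft_sets (T0_points X A T) A. (\<lambda>a\<in>A. {x \<in> X. T0_proj X A T x \<in> F a}) \<in> T}"

definition soft_T2 :: "'a set \<Rightarrow> 'p set \<Rightarrow> ('p \<Rightarrow> 'a set) set \<Rightarrow> bool" where
  "soft_T2 X A T \<longleftrightarrow>
     (\<forall>x\<in>X. \<forall>y\<in>X. x \<noteq> y \<longrightarrow>
        (\<exists>F\<in>T. \<exists>G\<in>T. soft_mem A x F \<and> soft_mem A y G \<and> soft_inter A F G = soft_null A))"

definition soft_T02 :: "'a set \<Rightarrow> 'p set \<Rightarrow> ('p \<Rightarrow> 'a set) set \<Rightarrow> bool" where
  "soft_T02 X A T \<longleftrightarrow> soft_T2 (T0_points X A T) A (T0_topology X A T)"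

lemma soft_equiv_iff_open:
  assumes "soft_topology X A T"
  shows "soft_equiv X A T x y \<longleftrightarrow> (\<forall>G\<in>T. soft_mem A x G \<longleftrightarrow> soft_mem A y G)"
proof -
  have *: "(\<forall>F\<in>soft_nbhds X A T u. soft_mem A v F) \<longleftrightarrow> (\<forall>G\<in>T. soft_mem A u G \<longrightarrow> soft_mem A v G)" for u v
  proof
    assume h: "\<forall>F\<in>soft_nbhds X A T u. soft_mem A v F"
    have "G \<in> soft_nbhds X A T u" if "G \<in> T" "soft_mem A u G" for G
      using that assms unfolding soft_nbhds_def soft_topology_def soft_le_def by blast
    with h show "\<forall>G\<in>T. soft_mem A u G \<longrightarrow> soft_mem A v G" by blast
  next
    assume "\<forall>G\<in>T. soft_mem A u G \<longrightarrow> soft_mem A v G"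
    then show "\<forall>F\<in>soft_nbhds X A T u. soft_mem A v F"
      unfolding soft_nbhds_def soft_mem_def soft_le_def by blast
  qed
  show ?thesis
    unfolding soft_equiv_def * by blast
qed

lemma equiv_soft_equiv_rel:
  assumes "soft_topology X A T"
  shows "equiv X (soft_equiv_rel X A T)"
  unfolding soft_equiv_rel_def soft_equiv_iff_open[OF assms]
  by (rule equivI) (auto simp: refl_on_def sym_def trans_def)

lemma soft_topology_T0_topology:
  assumes "soft_topology X A T"
  shows "soft_topology (T0_points X A T) A (T0_topology X A T)"
proof -
  define r where "r = T0_proj X A T"
  define Q where "Q = T0_points X A T"
  define pre where "pre F = (\<lambda>a\<in>A. {x \<in> X. r x \<in> F a})" for F
  have r: "r x \<in> Q" if "x \<in> X" for x
    using that by (auto simp: r_def Q_def T0_proj_def T0_points_def quotient_def)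
  have T0: "F \<in> T0_topology X A T \<longleftrightarrow> F \<in> soft_sets Q A \<and> pre F \<in> T" for F
    by (simp add: T0_topology_def pre_def r_def Q_def)
  have 1: "pre (soft_null A) = soft_null A"
    by (rule ext) (simp add: pre_def soft_null_def)
  have 2: "pre (soft_whole Q A) = soft_whole X A"
    by (rule ext) (use r in \<open>auto simp: pre_def soft_whole_def\<close>)
  have 3: "pre (soft_inter A F G) = soft_inter A (pre F) (pre G)" for F G
    by (rule ext) (auto simp: pre_def soft_inter_def)
  have 4: "pre (soft_Union A S) = soft_Union A (pre ` S)" for S
    by (rule ext) (auto simp: pre_def soft_Union_def)
  have 5: "soft_null A \<in> soft_sets Q A" "soft_whole Q A \<in> soft_sets Q A"
    by (auto simp: soft_sets_def soft_null_def soft_whole_def)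
  have 6: "soft_inter A F G \<in> soft_sets Q A" if "F \<in> soft_sets Q A" for F G
    using that by (auto simp: soft_sets_def soft_inter_def PiE_iff)
  have 7: "soft_Union A S \<in> soft_sets Q A" if "S \<subseteq> soft_sets Q A" for S
    using that unfolding soft_sets_def soft_Union_def by (auto simp: PiE_iff)
  have "soft_Union A S \<in> T0_topology X A T" if "S \<subseteq> T0_topology X A T" for S
  proof -
    have "pre ` S \<subseteq> T" "S \<subseteq> soft_sets Q A"
      using that T0 by auto
    then show ?thesis
      using assms 7 unfolding T0 4 soft_topology_def by blast
  qed
  moreover have "soft_inter A F G \<in> T0_topology X A T"
    if "F \<in> T0_topology X A T" "G \<in> T0_topology X A T" for F G
    using that assms 6 unfolding T0 3 soft_topology_def by blast
  moreover have "soft_null A \<in> T0_topology X A T" "soft_whole Q A \<in> T0_topology X A T"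
    using assms 5 unfolding T0 1 2 soft_topology_def by blast+
  moreover have "T0_topology X A T \<subseteq> soft_sets Q A"
    using T0 by blast
  ultimately show ?thesis
    unfolding soft_topology_def Q_def by blast
qed

end

theory Submission imports Defs begin

text \<open>
  In a soft \<open>T\<^sub>0\<^sub>U\<close> space no soft open set separates equivalent points at any parameter, so each
  value \<open>F a\<close> of a soft open set is a union of equivalence classes.  Hence \<open>F\<close> is the inverse image
  under the canonical surjection \<open>r\<close> of its own direct image, and taking inverse images is a map
  from the soft topology of the reflection \<^emph>\<open>onto\<close> \<open>T\<close> (\<open>pullback_image_T0_topology\<close>).  This map
  reflects and preserves the two relations that occur in the separation axiom: membership
  of a point (\<open>soft_mem_T0_proj_iff\<close>) and, since \<open>r\<close> is surjective, disjointness
  (\<open>disjoint_pullback_iff\<close>).  As \<open>r x \<noteq> r y\<close> says that \<open>x\<close> and \<open>y\<close> are inequivalent, soft \<open>T\<^sub>2\<close> for the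
  reflection translates word by word into the separation of inequivalent points by members of \<open>T\<close>.

  Without \<open>T\<^sub>0\<^sub>U\<close>, inverse images need not exhaust \<open>T\<close>: equivalence only
  compares points with respect to all parameters at once, and a soft open set may cut through an
  equivalence class at a single parameter.
\<close>

definition T0_pullback ::
    "'a set \<Rightarrow> 'p set \<Rightarrow> ('p \<Rightarrow> 'a set) set \<Rightarrow> ('p \<Rightarrow> 'a set set) \<Rightarrow> 'p \<Rightarrow> 'a set" where
  "T0_pullback X A T F = (\<lambda>a\<in>A. {x \<in> X. T0_proj X A T x \<in> F a})"

lemma T0_topology_iff_pullback:
  "F \<in> T0_topology X A T \<longleftrightarrow> F \<in> soft_sets (T0_points X A T) A \<and> T0_pullback X A T F \<in> T"
  by (simp add: T0_topology_def T0_pullback_def)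

lemma T0_points_eq_image: "T0_points X A T = T0_proj X A T ` X"
  by (auto simp: T0_points_def T0_proj_def quotient_def)

lemma T0_proj_eq_iff:
  assumes "soft_topology X A T" and "x \<in> X" and "y \<in> X"
  shows "T0_proj X A T x = T0_proj X A T y \<longleftrightarrow> soft_equiv X A T x y"
  using eq_equiv_class_iff[OF equiv_soft_equiv_rel[OF assms(1)] assms(2,3)] assms(2,3)
  by (simp add: T0_proj_def soft_equiv_rel_def)

lemma soft_mem_T0_proj_iff:
  assumes "x \<in> X"
  shows "soft_mem A (T0_proj X A T x) F \<longleftrightarrow> soft_mem A x (T0_pullback X A T F)"
  using assms by (simp add: soft_mem_def T0_pullback_def)

lemma soft_inter_eq_null_iff:
  "soft_inter A F G = soft_null A \<longleftrightarrow> (\<forall>a\<in>A. F a \<inter> G a = {})"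
  by (auto simp: soft_inter_def soft_null_def fun_eq_iff restrict_def)

text \<open>
  A common point of \<open>F a\<close> and \<open>G a\<close> is a class, and every class has a representative in \<open>X\<close>; this
  representative is then a common point of the inverse images.
\<close>

lemma disjoint_pullback_iff:
  assumes "F \<in> soft_sets (T0_points X A T) A"
  shows "soft_inter A (T0_pullback X A T F) (T0_pullback X A T G) = soft_null A
    \<longleftrightarrow> soft_inter A F G = soft_null A"
proof -
  have "F a \<subseteq> T0_proj X A T ` X" if "a \<in> A" for a
    using assms that by (auto simp: soft_sets_def T0_points_eq_image PiE_iff)
  then show ?thesis
    unfolding soft_inter_eq_null_iff by (auto simp: T0_pullback_def)
qed

text \<open>
  This is where \<open>T\<^sub>0\<^sub>U\<close> enters: a point of \<open>X\<close> whose class meets \<open>F a\<close> is equivalent to a point of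
  \<open>F a\<close> and so lies in \<open>F a\<close> itself.
\<close>

lemma pullback_direct_image:
  assumes "soft_topology X A T" and "soft_T0U X A T" and "F \<in> T"
  shows "T0_pullback X A T (\<lambda>a\<in>A. T0_proj X A T ` F a) = F"
proof
  fix a
  have F: "F \<in> A \<rightarrow>\<^sub>E Pow X"
    using assms(1,3) by (auto simp: soft_topology_def soft_sets_def)
  show "T0_pullback X A T (\<lambda>a\<in>A. T0_proj X A T ` F a) a = F a"
  proof (cases "a \<in> A")
    case True
    then have sub: "F a \<subseteq> X"
      using F by auto
    have "x \<in> F a" if "x \<in> X" "y \<in> F a" "T0_proj X A T x = T0_proj X A T y" for x y
      using that sub True assms T0_proj_eq_iff[OF assms(1), of x y]
      unfolding soft_T0U_def by blast
    then show ?thesis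
      using sub True by (auto simp: T0_pullback_def)
  next
    case False
    then show ?thesis
      using F by (simp add: T0_pullback_def PiE_arb[OF F])
  qed
qed

lemma pullback_image_T0_topology:
  assumes "soft_topology X A T" and "soft_T0U X A T"
  shows "T0_pullback X A T ` T0_topology X A T = T"
proof
  show "T0_pullback X A T ` T0_topology X A T \<subseteq> T"
    by (auto simp: T0_topology_iff_pullback)
  show "T \<subseteq> T0_pullback X A T ` T0_topology X A T"
  proof
    fix F assume F: "F \<in> T"
    let ?I = "\<lambda>a\<in>A. T0_proj X A T ` F a"
    have "?I \<in> soft_sets (T0_points X A T) A"
      using F assms(1)
      by (fastforce simp: soft_topology_def soft_sets_def T0_points_eq_image PiE_iff)
    then have "?I \<in> T0_topology X A T"
      using F pullback_direct_image[OF assms F] by (simp add: T0_topology_iff_pullback)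
    then show "F \<in> T0_pullback X A T ` T0_topology X A T"
      using pullback_direct_image[OF assms F] by (metis imageI)
  qed
qed

theorem proposition4p5:
  fixes X :: "'a set" and A :: "'p set" and T :: "('p \<Rightarrow> 'a set) set"
  assumes "soft_topology X A T" and "soft_T0U X A T"
  shows "soft_T02 X A T \<longleftrightarrow>
    (\<forall>x\<in>X. \<forall>y\<in>X. \<not> soft_equiv X A T x y \<longrightarrow>
       (\<exists>G\<in>T. \<exists>H\<in>T. soft_mem A x G \<and> soft_mem A y H \<and> soft_inter A G H = soft_null A))"
proof -
  let ?r = "T0_proj X A T" and ?T0 = "T0_topology X A T" and ?p = "T0_pullback X A T"
  have separated_iff:
    "(\<exists>F\<in>?T0. \<exists>G\<in>?T0. soft_mem A (?r x) F \<and> soft_mem A (?r y) G \<and> soft_inter A F G = soft_null A)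
     \<longleftrightarrow> (\<exists>G\<in>T. \<exists>H\<in>T. soft_mem A x G \<and> soft_mem A y H \<and> soft_inter A G H = soft_null A)"
    (is "?L \<longleftrightarrow> ?R") if "x \<in> X" "y \<in> X" for x y
  proof -
    have "?L \<longleftrightarrow> (\<exists>F\<in>?T0. \<exists>G\<in>?T0. soft_mem A x (?p F) \<and> soft_mem A y (?p G)
        \<and> soft_inter A (?p F) (?p G) = soft_null A)"
      by (intro bex_cong refl arg_cong2[where f = "(\<and>)"] soft_mem_T0_proj_iff
          disjoint_pullback_iff[symmetric] that) (simp add: T0_topology_iff_pullback)
    also have "\<dots> \<longleftrightarrow> (\<exists>G\<in>?p ` ?T0. \<exists>H\<in>?p ` ?T0. soft_mem A x G \<and> soft_mem A y H
        \<and> soft_inter A G H = soft_null A)"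
      by blast
    finally show ?thesis
      unfolding pullback_image_T0_topology[OF assms] .
  qed
  show ?thesis
    unfolding soft_T02_def soft_T2_def T0_points_eq_image ball_simps
    by (intro ball_cong refl arg_cong2[where f = "(\<longrightarrow>)"] separated_iff)
      (simp_all add: T0_proj_eq_iff[OF assms(1)])
qed

end
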